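(* Let $f : \mathbb{R}^d \to \mathbb{R}$ be an $(L_0, L_1)$-smooth function with $\inf f \in \mathbb{R}$ (i.e. $f$ is bounded below), and let $(x_t)_{t \in \mathbb{N}}$ be Clip-SGD iterates on $f$ with clipping constant $c > 0$, stepsize $\eta > 0$, and variance bound $\sigma^2 \in \mathbb{R}_+$ (with $\sigma \geq 0$). Define $\bar\beta = L_0 + c L_1$. If $\eta \bar\beta < 1$, then for $\Delta := \mathbb{E}[f(x_0)] - \inf f \in \mathbb{R}_+$ and $\zeta := 1/(1 - \eta \bar\beta)$, it holds for all integers $T \geq 1$ that $$ \frac{1}{T} \sum_{t=0}^{T-1} \mathbb{E}[\lVert \nabla f(x_t) \rVert_2] \leq \sqrt{\frac{2 \zeta \Delta}{\eta T}} + \frac{2 \zeta \Delta}{\eta T c} + 2 \zeta \sqrt{\eta \bar\beta}\, \sigma + 6 \zeta \min(\sigma^2 / c, 3 \sigma). $$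
   Context: A differentiable function $f : \mathbb{R}^d \to \mathbb{R}$ is $(L_0, L_1)$-smooth (with $L_0, L_1 \geq 0$) if for all $x, y \in \mathbb{R}^d$ with $\lVert x - y \rVert_2 \leq 1/L_1$ it holds that $\lVert \nabla f(x) - \nabla f(y) \rVert_2 \leq (L_0 + \lVert \nabla f(x) \rVert_2 L_1) \lVert x - y \rVert_2$. If $L_1 = 0$, $1/L_1$ is read as $+\infty$. For $c > 0$, $\mathrm{P}_c : \mathbb{R}^d \to \mathbb{R}^d$, $\mathrm{P}_c(v) = \min(1, c/\lVert v \rVert_2) \, v$, is the Euclidean projection onto $\{ x \in \mathbb{R}^d : \lVert x \rVert_2 \leq c \}$. The convention is $\min(1, c/0) = 1$. Clip-SGD iterates on $f$ with clipping constant $c > 0$, stepsize $\eta > 0$ and variance bound $\sigma^2$ form a random sequence with $x_{t+1} = x_t - \eta \, \mathrm{P}_c(\nabla f_\xi(x_t))$. Here $\xi$ is a fresh random sample drawn at each step independently of the past, and $\nabla f_\xi(x) \in \mathbb{R}^d$ denotes a stochastic gradient estimate (jointly measurable in $(x,\xi)$) satisfying, for every $x \in \mathbb{R}^d$, $\mathbb{E}_\xi[\nabla f_\xi(x)] = \nabla f(x)$ and $\mathbb{E}_\xi[\lVert \nabla f_\xi(x) - \nabla f(x) \rVert_2^2] \leq \sigma^2$. The initial point $x_0$ may be random, with $\mathbb{E}[f(x_0)]$ finite. *)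

theory Defs
  imports "HOL-Probability.Probability"
begin

definition gradient :: "('a::real_inner \<Rightarrow> real) \<Rightarrow> 'a \<Rightarrow> 'a"
  where "gradient f x = (THE D. GDERIV f x :> D)"

lemma gradient_eqI:
  assumes "GDERIV f x :> D"
  shows "gradient f x = D"
  unfolding gradient_def
proof (rule the_equality)
  show "GDERIV f x :> D" by (fact assms)
next
  fix D' assume "GDERIV f x :> D'"
  then have "(\<lambda>h. h \<bullet> D') = (\<lambda>h. h \<bullet> D)"
    using assms unfolding gderiv_def by (rule has_derivative_unique)
  then show "D' = D"
    by (simp add: fun_eq_iff vector_eq_ldot)
qed

lemma GDERIV_gradient:
  fixes f :: "'a::euclidean_space \<Rightarrow> real"
  assumes "f differentiable (at x)"
  shows "GDERIV f x :> gradient f x"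
proof -
  obtain f' where f': "(f has_derivative f') (at x)"
    using assms unfolding differentiable_def by blast
  then have lin: "linear f'"
    by (rule has_derivative_linear)
  have eq: "f' = (\<lambda>h. h \<bullet> adjoint f' 1)"
  proof
    show "f' h = h \<bullet> adjoint f' 1" for h
      unfolding adjoint_works[OF lin] by simp
  qed
  have "GDERIV f x :> adjoint f' 1"
    unfolding gderiv_def by (subst eq[symmetric]) (fact f')
  then show ?thesis
    by (simp only: gradient_eqI)
qed

text \<open>For \<open>L1 = 0\<close> the radius \<open>1 / L1\<close> is read as infinity, whereas \<open>1 / 0 = 0\<close> in HOL;
  hence the first disjunct.\<close>

definition L0_L1_smooth :: "real \<Rightarrow> real \<Rightarrow> ('a::real_inner \<Rightarrow> real) \<Rightarrow> bool"
  where "L0_L1_smooth L0 L1 f \<longleftrightarrow>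
    0 \<le> L0 \<and> 0 \<le> L1 \<and> (\<forall>x. f differentiable (at x)) \<and>
    (\<forall>x y. L1 = 0 \<or> norm (x - y) \<le> 1 / L1 \<longrightarrow>
      norm (gradient f x - gradient f y) \<le> (L0 + norm (gradient f x) * L1) * norm (x - y))"

text \<open>The convention \<open>min 1 (c / 0) = 1\<close> is made explicit.\<close>

definition clip :: "real \<Rightarrow> 'a::real_normed_vector \<Rightarrow> 'a"
  where "clip c v = (if v = 0 then 1 else min 1 (c / norm v)) *\<^sub>R v"

text \<open>\<open>M\<close> is the probability space carrying the whole process, and the sample \<open>\<xi> t\<close> drawn at
  step \<open>t\<close> has law \<open>D\<close>; \<open>G s z\<close> is the stochastic gradient at the point \<open>z\<close> for the sample \<open>s\<close>.
  The iterates \<open>x 1\<close>, ..., \<open>x t\<close> are functions of \<open>x 0\<close> and \<open>\<xi> 0\<close>, ..., \<open>\<xi> (t - 1)\<close>, so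
  the latter generate the entire past of step \<open>t\<close>. It is expressed as a preimage sigma-algebra because
  the library's \<open>indep_var\<close> requires both variables to have the same value type.
  Integrability is required explicitly as the Bochner integral of a non-integrable function is
  \<open>0\<close>.\<close>

locale clip_sgd = prob_space M + sample: prob_space D
  for M :: "'w measure" and D :: "'s measure" +
  fixes f :: "'a::euclidean_space \<Rightarrow> real"
    and G :: "'s \<Rightarrow> 'a \<Rightarrow> 'a"
    and c \<eta> \<sigma> :: real
    and \<xi> :: "nat \<Rightarrow> 'w \<Rightarrow> 's"
    and x :: "nat \<Rightarrow> 'w \<Rightarrow> 'a"
  assumes G_measurable: "(\<lambda>(z, s). G s z) \<in> borel_measurable (borel \<Otimes>\<^sub>M D)"
    and G_integrable: "\<And>z. integrable D (\<lambda>s. G s z)"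
    and G_unbiased: "\<And>z. sample.expectation (\<lambda>s. G s z) = gradient f z"
    and G_square_integrable: "\<And>z. integrable D (\<lambda>s. (norm (G s z - gradient f z))\<^sup>2)"
    and G_variance: "\<And>z. sample.expectation (\<lambda>s. (norm (G s z - gradient f z))\<^sup>2) \<le> \<sigma>\<^sup>2"
    and x0_measurable: "random_variable borel (x 0)"
    and x0_integrable: "integrable M (\<lambda>\<omega>. f (x 0 \<omega>))"
    and \<xi>_measurable: "\<And>t. random_variable D (\<xi> t)"
    and \<xi>_distr: "\<And>t. distr M D (\<xi> t) = D"
    and \<xi>_fresh: "\<And>t. indep_set
      (sets (vimage_algebra (space M) (\<lambda>\<omega>. (x 0 \<omega>, \<lambda>i\<in>{..<t}. \<xi> i \<omega>))
        (borel \<Otimes>\<^sub>M Pi\<^sub>M {..<t} (\<lambda>_. D))))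
      (sets (vimage_algebra (space M) (\<xi> t) D))"
    and x_step: "\<And>t \<omega>. \<omega> \<in> space M \<Longrightarrow>
      x (Suc t) \<omega> = x t \<omega> - \<eta> *\<^sub>R clip c (G (\<xi> t \<omega>) (x t \<omega>))"

end

theory Submission
  imports Defs
begin

text \<open>Write \<open>g = \<nabla>f z\<close>, \<open>a = \<parallel>g\<parallel>\<close> and \<open>\<phi> = a min(a, c) = \<langle>g, P\<^sub>c(g)\<rangle>\<close>. Since \<open>\<eta> c L1 \<le> 1\<close>, every
  step stays within the radius of the smoothness assumption, so that
  \<open>f(z\<^sub>+) \<le> f(z) - \<eta> \<langle>g, P\<rangle> + \<eta>\<^sup>2/2 (L0 + L1 a) \<parallel>P\<parallel>\<^sup>2\<close> for the clipped estimate \<open>P\<close>. Here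
  \<open>(L0 + L1 a) E\<parallel>P\<parallel>\<^sup>2 \<le> \<beta> (\<phi> + min(\<sigma>\<^sup>2, c\<^sup>2))\<close>, and the bias of clipping is controlled
  by \<open>E\<langle>g, P\<rangle> \<ge> \<phi>/2 - W/2\<close> with \<open>W\<close> depending only on \<open>c\<close> and \<open>\<sigma>\<close>. Only half of \<open>\<phi>\<close> is
  needed because the other half is lost to the normalisation by \<open>1 - \<eta> \<beta>\<close> anyway; this makes the error
  \<open>W\<close> uniform in \<open>a\<close>. Telescoping bounds the mean of \<open>E \<phi>\<close> by \<open>R = 2\<zeta>\<Delta>/(\<eta>T) + \<zeta>(W + \<eta>\<beta> min(\<sigma>\<^sup>2, c\<^sup>2))\<close>,
  and \<open>a \<le> \<phi>/c + (\<phi>/s + s)/2\<close> with \<open>s = \<surd>R\<close> turns this into \<open>\<surd>R + R/c\<close> for the mean of \<open>E a\<close>.\<close>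

section \<open>Clipping as a projection\<close>

lemma clip_eq_scaleR:
  assumes "0 < c"
  obtains r where "0 \<le> r" "clip c v = r *\<^sub>R v"
  using assms that[of "if v = 0 then 1 else min 1 (c / norm v)"]
  by (auto simp: clip_def)

lemma clip_inside: "norm v \<le> c \<Longrightarrow> clip c v = v"
  by (auto simp: clip_def min_def divide_simps)

lemma clip_outside: "0 < c \<Longrightarrow> c \<le> norm v \<Longrightarrow> clip c v = (c / norm v) *\<^sub>R v"
  by (auto simp: clip_def min_def divide_simps)

lemma norm_clip: "0 < c \<Longrightarrow> norm (clip c v) = min c (norm v)"
  by (cases "norm v \<le> c") (auto simp: clip_inside clip_outside)

lemma norm_diff_clip:
  assumes "0 < c"
  shows "norm (v - clip c v) = max 0 (norm v - c)"
proof (cases "norm v \<le> c")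
  case False
  then have nz: "norm v > 0" using assms by linarith
  have "v - clip c v = (1 - c / norm v) *\<^sub>R v"
    using False assms by (simp add: clip_outside scaleR_left_diff_distrib)
  moreover have "1 - c / norm v \<ge> 0"
    using False nz by simp
  ultimately have "norm (v - clip c v) = (1 - c / norm v) * norm v"
    by simp
  also have "\<dots> = norm v - c" using nz by (simp add: field_simps)
  finally show ?thesis using False by simp
qed (simp add: clip_inside)

text \<open>By the triangle inequality every point of the ball is at distance at least
  \<open>norm v - c\<close> from \<open>v\<close>, and clipping attains this distance. Projections
  onto closed convex sets are 1-Lipschitz, which is what the identification is for.\<close>

lemma clip_eq_closest_point:
  fixes v :: "'a::euclidean_space"
  assumes "0 < c"
  shows "clip c v = closest_point (cball 0 c) v"
proof (rule closest_point_unique)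
  show "clip c v \<in> cball 0 c"
    using assms by (simp add: norm_clip)
  show "\<forall>z\<in>cball 0 c. dist v (clip c v) \<le> dist v z"
  proof
    fix z :: 'a assume "z \<in> cball 0 c"
    then have "norm v - c \<le> norm (v - z)"
      using norm_triangle_ineq2[of v z] by simp
    then show "dist v (clip c v) \<le> dist v z"
      using assms by (simp add: dist_norm norm_diff_clip)
  qed
qed auto

lemma norm_clip_diff_le:
  fixes v w :: "'a::euclidean_space"
  assumes "0 < c"
  shows "norm (clip c v - clip c w) \<le> norm (v - w)"
  using closest_point_lipschitz[of "cball 0 c" v w] assms
  by (simp add: clip_eq_closest_point dist_norm)

lemma borel_measurable_clip [measurable]:
  "clip c \<in> borel_measurable (borel :: 'a::euclidean_space measure)"
  unfolding clip_def[abs_def] by measurable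

section \<open>Pointwise lower bounds for the inner product with a clipped vector\<close>

lemma inner_clip_self:
  fixes g :: "'a::real_inner"
  assumes "0 < c"
  shows "g \<bullet> clip c g = norm g * min (norm g) c"
proof (cases "norm g \<le> c")
  case True
  then show ?thesis by (simp add: clip_inside dot_square_norm power2_eq_square)
next
  case False
  then show ?thesis using assms
    by (simp add: clip_outside dot_square_norm power2_eq_square)
qed

text \<open>Replacing \<open>v\<close> by \<open>g\<close> inside the clipping moves the result by
  at most \<open>norm (v - g)\<close>, as the projection is nonexpansive.\<close>

lemma inner_clip_ge_minus_dist:
  fixes g v :: "'a::euclidean_space"
  assumes "0 < c"
  shows "g \<bullet> clip c v \<ge> norm g * (min (norm g) c - norm (v - g))"
proof -
  have "\<bar>g \<bullet> (clip c v - clip c g)\<bar> \<le> norm g * norm (clip c v - clip c g)"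
    by (rule Cauchy_Schwarz_ineq2)
  also have "\<dots> \<le> norm g * norm (v - g)"
    using norm_clip_diff_le[OF assms] by (intro mult_left_mono) auto
  finally show ?thesis
    using inner_clip_self[OF assms, of g] by (simp add: inner_diff_right algebra_simps)
qed

lemma inner_clip_ge:
  assumes "0 < c"
  shows "(g :: 'a::real_inner) \<bullet> clip c v \<ge> - (norm g * c)"
proof -
  have "\<bar>g \<bullet> clip c v\<bar> \<le> norm g * norm (clip c v)"
    by (rule Cauchy_Schwarz_ineq2)
  also have "\<dots> \<le> norm g * c"
    using assms by (intro mult_left_mono) (auto simp: norm_clip)
  finally show ?thesis by linarith
qed

text \<open>Noise no longer than \<open>g\<close> cannot push \<open>v\<close> out of the half-space
  of directions with nonnegative inner product, and clipping only rescales \<open>v\<close>.\<close>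

lemma inner_clip_nonneg:
  assumes c: "0 < c" and le: "norm (v - g) \<le> norm g"
  shows "0 \<le> (g :: 'a::real_inner) \<bullet> clip c v"
proof -
  obtain r where r: "0 \<le> r" "clip c v = r *\<^sub>R v"
    using clip_eq_scaleR[OF c] by blast
  have "\<bar>g \<bullet> (v - g)\<bar> \<le> norm g * norm (v - g)"
    by (rule Cauchy_Schwarz_ineq2)
  also have "\<dots> \<le> norm g * norm g" using le by (intro mult_left_mono) auto
  finally have "0 \<le> g \<bullet> v"
    by (simp add: inner_diff_right dot_square_norm power2_eq_square)
  with r show ?thesis by simp
qed

text \<open>Here \<open>norm v\<close> is at least \<open>norm g / 2\<close> and hence at least
  \<open>c\<close>, so the clipped vector has length \<open>c\<close> and only the angle between
  \<open>v\<close> and \<open>g\<close> matters. Expanding the square of \<open>norm (v - g)\<close>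
  shows that its cosine is at least 1/2.\<close>

lemma inner_clip_ge_half:
  fixes g v :: "'a::real_inner"
  assumes c: "0 < c" and a: "2 * c \<le> norm g" and le: "norm (v - g) \<le> norm g / 2"
  shows "norm g * c / 2 \<le> g \<bullet> clip c v"
proof -
  have nv: "c \<le> norm v"
    using a le norm_triangle_ineq2[of g "g - v"] by (simp add: norm_minus_commute)
  have "(norm (v - g))\<^sup>2 \<le> (norm g / 2)\<^sup>2"
    using le by (intro power_mono) auto
  then have "(norm v)\<^sup>2 + (norm g)\<^sup>2 - 2 * (g \<bullet> v) \<le> (norm g)\<^sup>2 / 4"
    by (simp add: power2_norm_eq_inner inner_diff_left inner_diff_right inner_commute power_divide)
  moreover have "norm g * norm v \<le> (norm v)\<^sup>2 + (norm g)\<^sup>2 / 4"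
    using zero_le_power2[of "norm v - norm g / 2"] by (simp add: power2_eq_square algebra_simps)
  moreover have "0 \<le> (norm g)\<^sup>2" by simp
  ultimately have "norm g * norm v / 2 \<le> g \<bullet> v"
    by linarith
  then have "c / norm v * (norm g * norm v / 2) \<le> c / norm v * (g \<bullet> v)"
    using c by (intro mult_left_mono) auto
  moreover have "c / norm v * (norm g * norm v / 2) = norm g * c / 2"
    using nv c by (subst times_divide_times_eq) (auto simp: divide_simps)
  ultimately show ?thesis
    using nv c by (simp add: clip_outside)
qed

text \<open>For \<open>a\<close> up to \<open>2 * c\<close>, completing the square bounds
  \<open>a * \<nu>\<close> by \<open>\<nu>\<^sup>2 + a\<^sup>2 / 4\<close>. Beyond that, noise up to
  \<open>a / 2\<close> costs nothing, noise up to \<open>a\<close> keeps the inner product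
  nonnegative, and larger noise leaves at least \<open>- (a * c)\<close>. The shortfalls
  \<open>a * c / 2\<close> and \<open>3 / 2 * a * c\<close> are then covered by
  \<open>\<nu>\<^sup>2\<close>, as \<open>a * c\<close> is at most
  \<open>a\<^sup>2 / 2\<close>.\<close>

lemma inner_clip_ge_quadratic:
  fixes g v :: "'a::euclidean_space"
  assumes c: "0 < c"
  shows "norm g * min (norm g) c / 2 - (norm (v - g))\<^sup>2 \<le> g \<bullet> clip c v"
proof -
  define a where "a = norm g"
  define \<nu> where "\<nu> = norm (v - g)"
  have nn: "0 \<le> a" "0 \<le> \<nu>" by (simp_all add: a_def \<nu>_def)
  have 1: "a * (min a c - \<nu>) \<le> g \<bullet> clip c v"
    unfolding a_def \<nu>_def by (rule inner_clip_ge_minus_dist[OF c])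
  have sq: "0 \<le> (\<nu> - a / 2)\<^sup>2" by simp
  have "a * min a c / 2 - \<nu>\<^sup>2 \<le> g \<bullet> clip c v"
  proof -
    consider "a \<le> c" | "c < a" "a \<le> 2 * c" | "2 * c < a" "\<nu> \<le> a / 2"
      | "2 * c < a" "a / 2 < \<nu>" "\<nu> \<le> a" | "2 * c < a" "a < \<nu>" by linarith
    then show ?thesis
    proof cases
      case 1
      have "(\<nu> - a / 2)\<^sup>2 = \<nu>\<^sup>2 - a * \<nu> + a\<^sup>2 / 4"
        by (simp add: power2_eq_square algebra_simps)
      with sq zero_le_power2[of a] have "a\<^sup>2 / 2 - \<nu>\<^sup>2 \<le> a\<^sup>2 - a * \<nu>" by linarith
      then show ?thesis
        using \<open>a * (min a c - \<nu>) \<le> g \<bullet> clip c v\<close> 1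
        by (simp add: power2_eq_square right_diff_distrib)
    next
      case 2
      then have "a\<^sup>2 \<le> 2 * (a * c)" using nn mult_left_mono[of a "2 * c" a] by (simp add: power2_eq_square)
      moreover have "(\<nu> - a / 2)\<^sup>2 = \<nu>\<^sup>2 - a * \<nu> + a\<^sup>2 / 4"
        by (simp add: power2_eq_square algebra_simps)
      ultimately have "a * c / 2 - \<nu>\<^sup>2 \<le> a * c - a * \<nu>" using sq by linarith
      then show ?thesis
        using \<open>a * (min a c - \<nu>) \<le> g \<bullet> clip c v\<close> 2
        by (simp add: right_diff_distrib)
    next
      case 3
      have "a * c / 2 \<le> g \<bullet> clip c v"
        using inner_clip_ge_half[OF c, of g v] 3 by (simp add: a_def \<nu>_def)
      moreover have "min a c = c" using 3 c by simp
      ultimately show ?thesis using zero_le_power2[of \<nu>] by (metis diff_left_mono diff_zero order_trans)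
    next
      case 4
      have "0 \<le> g \<bullet> clip c v"
        using inner_clip_nonneg[OF c, of v g] 4 by (simp add: a_def \<nu>_def)
      moreover have "2 * (a * c) \<le> a\<^sup>2"
        using mult_left_mono[of "2 * c" a a] 4 nn by (simp add: power2_eq_square)
      moreover have "a\<^sup>2 \<le> 4 * \<nu>\<^sup>2"
        using power_mono[of a "2 * \<nu>" 2] 4 nn by (simp add: power_mult_distrib)
      moreover have "min a c = c" using 4 c by simp
      ultimately show ?thesis by (simp only:)
    next
      case 5
      have "- (a * c) \<le> g \<bullet> clip c v"
        using inner_clip_ge[OF c, of g v] by (simp add: a_def)
      moreover have "2 * (a * c) \<le> a\<^sup>2"
        using mult_left_mono[of "2 * c" a a] 5 nn by (simp add: power2_eq_square)
      moreover have "a\<^sup>2 \<le> \<nu>\<^sup>2"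
        using 5 nn by (intro power_mono) auto
      moreover have "min a c = c" "0 \<le> a * c" using 5 c nn by auto
      ultimately show ?thesis by (simp only:)
    qed
  qed
  then show ?thesis by (simp add: a_def \<nu>_def)
qed

text \<open>The factor 3 comes from large gradients with noise above \<open>a / 2\<close>: falling
  from \<open>a * c / 2\<close> to the worst value \<open>- (a * c)\<close> loses
  \<open>3 / 2 * a * c\<close>, which is less than \<open>3 * c * \<nu>\<close>.\<close>

lemma inner_clip_ge_linear:
  fixes g v :: "'a::euclidean_space"
  assumes c: "0 < c"
  shows "norm g * min (norm g) c / 2 - 3 * c * norm (v - g) \<le> g \<bullet> clip c v"
proof -
  define a where "a = norm g"
  define \<nu> where "\<nu> = norm (v - g)"
  have nn: "0 \<le> a" "0 \<le> \<nu>" by (simp_all add: a_def \<nu>_def)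
  have 1: "a * (min a c - \<nu>) \<le> g \<bullet> clip c v"
    unfolding a_def \<nu>_def by (rule inner_clip_ge_minus_dist[OF c])
  have "a * min a c / 2 - 3 * c * \<nu> \<le> g \<bullet> clip c v"
  proof -
    consider "a \<le> 2 * c" | "2 * c < a" "\<nu> \<le> a / 2" | "2 * c < a" "a / 2 < \<nu>" by linarith
    then show ?thesis
    proof cases
      case 1
      then have "a * \<nu> \<le> 2 * c * \<nu>" using nn by (intro mult_right_mono) auto
      moreover have "0 \<le> a * min a c" "0 \<le> c * \<nu>" using nn c by auto
      ultimately show ?thesis
        using \<open>a * (min a c - \<nu>) \<le> g \<bullet> clip c v\<close> by (simp add: algebra_simps)
    next
      case 2
      have "a * c / 2 \<le> g \<bullet> clip c v"
        using inner_clip_ge_half[OF c, of g v] 2 by (simp add: a_def \<nu>_def)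
      moreover have "0 \<le> c * \<nu>" using nn c by auto
      ultimately show ?thesis using 2 c by (simp add: min_def)
    next
      case 3
      have "- (a * c) \<le> g \<bullet> clip c v"
        using inner_clip_ge[OF c, of g v] by (simp add: a_def)
      moreover have "c * (a / 2) \<le> c * \<nu>" using 3 c by (intro mult_left_mono) auto
      moreover have "min a c = c" using 3 c by simp
      ultimately show ?thesis by (simp add: mult.commute[of a c] del: mult_le_cancel_left_pos)
    qed
  qed
  then show ?thesis by (simp add: a_def \<nu>_def)
qed

text \<open>Young's inequality with weight \<open>m\<close> turns the noise into its square and
  gives up a quarter of \<open>min (norm g) c\<close>. Of the remaining three quarters, one more can
  later absorb the variance and still leave the half that is wanted.\<close>

lemma inner_clip_ge_three_quarters:
  fixes g v :: "'a::euclidean_space"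
  assumes c: "0 < c" and m: "0 < m" "m \<le> norm g" "m \<le> c"
  shows "norm g * (3 / 4 * min (norm g) c - (norm (v - g))\<^sup>2 / m) \<le> g \<bullet> clip c v"
proof -
  have "0 \<le> (norm (v - g) - m / 2)\<^sup>2" by simp
  then have "norm (v - g) * m \<le> (norm (v - g))\<^sup>2 + m * m / 4"
    by (simp add: power2_eq_square algebra_simps)
  then have "norm (v - g) \<le> (norm (v - g))\<^sup>2 / m + m / 4"
    using m(1) by (simp add: field_simps)
  with m have "norm (v - g) \<le> (norm (v - g))\<^sup>2 / m + min (norm g) c / 4"
    by (simp add: min_def)
  then have "norm g * (3 / 4 * min (norm g) c - (norm (v - g))\<^sup>2 / m)
      \<le> norm g * (min (norm g) c - norm (v - g))"
    by (intro mult_left_mono) auto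
  with inner_clip_ge_minus_dist[OF c, of g v] show ?thesis by linarith
qed

text \<open>The term linear in \<open>v - g\<close> vanishes in expectation, which leaves a bias of order \<open>\<sigma>\<^sup>2/c\<close>
  rather than \<open>\<sigma>\<close>.\<close>

lemma inner_clip_ge_unbiased:
  fixes g v :: "'a::real_inner"
  assumes c: "0 < c" and a: "norm g \<le> c / 2"
  shows "(norm g)\<^sup>2 + g \<bullet> (v - g) - norm g / (2 * c) * (norm (v - g))\<^sup>2 \<le> g \<bullet> clip c v"
proof -
  have "norm v \<le> norm g + norm (v - g)"
    using norm_triangle_ineq[of g "v - g"] by simp
  moreover have "norm (v - g) - c / 2 \<le> (norm (v - g))\<^sup>2 / (2 * c)"
  proof -
    have "0 \<le> (norm (v - g) - c)\<^sup>2" by simp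
    then show ?thesis using c by (simp add: power2_eq_square field_simps)
  qed
  moreover have "0 \<le> (norm (v - g))\<^sup>2 / (2 * c)" using c by simp
  ultimately have "norm (v - clip c v) \<le> (norm (v - g))\<^sup>2 / (2 * c)"
    using a by (simp add: norm_diff_clip[OF c])
  then have "norm g * norm (v - clip c v) \<le> norm g * ((norm (v - g))\<^sup>2 / (2 * c))"
    by (intro mult_left_mono) auto
  moreover have "g \<bullet> (v - clip c v) \<le> norm g * norm (v - clip c v)"
    by (rule norm_cauchy_schwarz)
  ultimately show ?thesis
    by (simp add: inner_diff_right dot_square_norm)
qed

text \<open>For small \<open>\<sigma>\<close> the bias is of order \<open>\<sigma>\<^sup>2/c\<close> and enters squared, after maximising
  \<open>a \<sigma>\<^sup>2/(2c) - a\<^sup>2/2\<close> over \<open>a\<close>; for \<open>\<sigma>\<close> beyond \<open>3c\<close> the linear bound is the better one.\<close>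

definition bias_term :: "real \<Rightarrow> real \<Rightarrow> real"
  where "bias_term c \<sigma> =
    (if \<sigma> \<le> c / 4 then \<sigma> ^ 4 / (4 * c\<^sup>2)
     else if \<sigma> \<le> c / 2 then \<sigma>\<^sup>2
     else if \<sigma> \<le> 3 * c then 2 * \<sigma>\<^sup>2
     else 6 * c * \<sigma>)"

lemma bias_term_nonneg: "0 < c \<Longrightarrow> 0 \<le> \<sigma> \<Longrightarrow> 0 \<le> bias_term c \<sigma>"
  by (simp add: bias_term_def)

text \<open>The first two summands are the contribution of the bias to
  \<open>sqrt R + R / c\<close>; the third bounds the contribution of the curvature noise to
  \<open>R / c\<close>. In units of \<open>\<sigma>\<^sup>2 / c\<close> the two middle regimes add
  up to \<open>4 + 1 + 1\<close> and \<open>3 + 2 + 1\<close>, which is where the constant 6 comes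
  from.\<close>

lemma sqrt_bias_term_le:
  assumes c: "0 < c" and \<sigma>: "0 \<le> \<sigma>"
  shows "sqrt (bias_term c \<sigma>) + bias_term c \<sigma> / c + min \<sigma> (\<sigma>\<^sup>2 / c)
    \<le> 6 * min (\<sigma>\<^sup>2 / c) (3 * \<sigma>)"
proof -
  have sqrt2: "sqrt 2 \<le> 3 / 2"
    by (rule real_le_lsqrt) (auto simp: power2_eq_square)
  have small: "\<sigma>\<^sup>2 / c \<le> 3 * \<sigma>" if "\<sigma> \<le> 3 * c"
    using mult_left_mono[OF that \<sigma>] c by (simp add: field_simps power2_eq_square)
  consider "\<sigma> \<le> c / 4" | "c / 4 < \<sigma>" "\<sigma> \<le> c / 2" | "c / 2 < \<sigma>" "\<sigma> \<le> 3 * c" | "3 * c < \<sigma>"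
    by linarith
  then show ?thesis
  proof cases
    case 1
    have W: "bias_term c \<sigma> = (\<sigma>\<^sup>2 / (2 * c))\<^sup>2"
      using 1 by (simp add: bias_term_def power_divide power_mult_distrib flip: power_mult)
    have s: "sqrt (bias_term c \<sigma>) = \<sigma>\<^sup>2 / c / 2"
      unfolding W using c by simp
    have "\<sigma>\<^sup>2 \<le> c\<^sup>2" using 1 \<sigma> c by (intro power_mono) auto
    also have "\<dots> \<le> c * (2 * c)" using c by (simp add: power2_eq_square)
    finally have "\<sigma>\<^sup>2 / (2 * c) \<le> c" using c by (simp add: pos_divide_le_eq)
    then have "(\<sigma>\<^sup>2 / (2 * c)) * (\<sigma>\<^sup>2 / (2 * c)) \<le> \<sigma>\<^sup>2 / (2 * c) * c"
      using c by (intro mult_left_mono) auto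
    also have "\<dots> \<le> \<sigma>\<^sup>2" using c by simp
    finally have "bias_term c \<sigma> / c \<le> \<sigma>\<^sup>2 / c"
      using c unfolding W power2_eq_square[of "_ / _"] by (intro divide_right_mono) auto
    moreover have "0 \<le> \<sigma>\<^sup>2 / c" using c by simp
    moreover have "min (\<sigma>\<^sup>2 / c) (3 * \<sigma>) = \<sigma>\<^sup>2 / c" using small 1 c by simp
    moreover have "min \<sigma> (\<sigma>\<^sup>2 / c) \<le> \<sigma>\<^sup>2 / c" by simp
    ultimately show ?thesis using s by simp
  next
    case 2
    then have W: "bias_term c \<sigma> = \<sigma>\<^sup>2" using c by (simp add: bias_term_def)
    have "\<sigma> * (c / 4) \<le> \<sigma> * \<sigma>" using 2 \<sigma> by (intro mult_left_mono) auto
    then have "\<sigma> \<le> 4 * (\<sigma>\<^sup>2 / c)" using c by (simp add: field_simps power2_eq_square)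
    then show ?thesis unfolding W using small 2 \<sigma> c by simp
  next
    case 3
    then have W: "bias_term c \<sigma> = 2 * \<sigma>\<^sup>2" using c by (simp add: bias_term_def)
    have "\<sigma> * (c / 2) \<le> \<sigma> * \<sigma>" using 3 \<sigma> by (intro mult_left_mono) auto
    then have "\<sigma> \<le> 2 * (\<sigma>\<^sup>2 / c)" using c by (simp add: field_simps power2_eq_square)
    moreover have "sqrt (2 * \<sigma>\<^sup>2) \<le> 3 / 2 * \<sigma>"
      using mult_right_mono[OF sqrt2 \<sigma>] \<sigma> by (simp add: real_sqrt_mult)
    ultimately show ?thesis unfolding W using small 3 \<sigma> c by simp
  next
    case 4
    then have W: "bias_term c \<sigma> = 6 * c * \<sigma>" using c by (simp add: bias_term_def)
    have "3 * c * \<sigma> \<le> \<sigma> * \<sigma>" using 4 \<sigma> by (intro mult_right_mono) auto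
    then have large: "3 * \<sigma> \<le> \<sigma>\<^sup>2 / c" and "3 * c * \<sigma> \<le> \<sigma>\<^sup>2"
      using c by (auto simp: field_simps power2_eq_square)
    moreover have "(2 * \<sigma>)\<^sup>2 = 2 * \<sigma>\<^sup>2 + 2 * \<sigma>\<^sup>2" "6 * c * \<sigma> = 2 * (3 * c * \<sigma>)"
      by (simp_all add: power_mult_distrib)
    ultimately have "6 * c * \<sigma> \<le> (2 * \<sigma>)\<^sup>2"
      by (simp only: add_increasing2 zero_le_power2 mult_left_mono zero_le_numeral mult_nonneg_nonneg)
    then have "sqrt (6 * c * \<sigma>) \<le> 2 * \<sigma>"
      using c \<sigma> by (intro real_le_lsqrt) auto
    with large show ?thesis unfolding W using \<sigma> c by simp
  qed
qed

section \<open>Consequences of smoothness\<close>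

text \<open>Along the segment from \<open>z\<close> to \<open>z + d\<close> the gradient drifts from
  its value at \<open>z\<close> at most linearly, with the rate \<open>K\<close> fixed at
  \<open>z\<close>. Hence \<open>h\<close>, the difference between \<open>f\<close> and its
  quadratic model, is nonincreasing.\<close>

lemma L0_L1_smooth_upper_bound:
  fixes f :: "'a::euclidean_space \<Rightarrow> real"
  assumes smooth: "L0_L1_smooth L0 L1 f" and near: "L1 = 0 \<or> norm d \<le> 1 / L1"
  shows "f (z + d) \<le> f z + gradient f z \<bullet> d + (L0 + L1 * norm (gradient f z)) / 2 * (norm d)\<^sup>2"
proof -
  define K where "K = L0 + L1 * norm (gradient f z)"
  have K: "0 \<le> K" using smooth by (simp add: K_def L0_L1_smooth_def)
  define h where "h t = f (z + t *\<^sub>R d) - t * (gradient f z \<bullet> d) - t\<^sup>2 / 2 * (K * (norm d)\<^sup>2)" for t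
  have "h 1 \<le> h 0"
  proof (rule DERIV_nonpos_imp_nonincreasing[of 0 1 h])
    fix t :: real assume t: "0 \<le> t" "t \<le> 1"
    have "GDERIV f (z + t *\<^sub>R d) :> gradient f (z + t *\<^sub>R d)"
      using smooth by (intro GDERIV_gradient) (auto simp: L0_L1_smooth_def)
    then have "(f has_derivative (\<lambda>h. h \<bullet> gradient f (z + t *\<^sub>R d))) (at (z + t *\<^sub>R d))"
      by (simp add: gderiv_def)
    moreover have "((\<lambda>t. z + t *\<^sub>R d) has_derivative (\<lambda>s. s *\<^sub>R d)) (at t)"
      by (auto intro!: derivative_eq_intros)
    ultimately have "((\<lambda>t. f (z + t *\<^sub>R d)) has_derivative
        (\<lambda>s. (s *\<^sub>R d) \<bullet> gradient f (z + t *\<^sub>R d))) (at t)"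
      using has_derivative_compose by blast
    then have *: "((\<lambda>t. f (z + t *\<^sub>R d)) has_real_derivative d \<bullet> gradient f (z + t *\<^sub>R d)) (at t)"
      by (simp add: has_field_derivative_def mult.commute[of _ "d \<bullet> _"])
    have deriv: "(h has_real_derivative
        d \<bullet> gradient f (z + t *\<^sub>R d) - gradient f z \<bullet> d - t * (K * (norm d)\<^sup>2)) (at t)"
      unfolding h_def by (auto intro!: derivative_eq_intros *)
    have "norm d * t \<le> norm d"
      using t by (simp add: mult_left_le)
    with near have near': "L1 = 0 \<or> norm (z - (z + t *\<^sub>R d)) \<le> 1 / L1"
      using t by (auto simp: mult.commute)
    have "d \<bullet> gradient f (z + t *\<^sub>R d) - gradient f z \<bullet> d
        = d \<bullet> (gradient f (z + t *\<^sub>R d) - gradient f z)"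
      by (simp add: inner_diff_right inner_commute)
    also have "\<dots> \<le> norm d * norm (gradient f (z + t *\<^sub>R d) - gradient f z)"
      by (rule norm_cauchy_schwarz)
    also have "\<dots> \<le> norm d * (K * norm (z - (z + t *\<^sub>R d)))"
    proof (rule mult_left_mono)
      have "norm (gradient f z - gradient f (z + t *\<^sub>R d)) \<le> K * norm (z - (z + t *\<^sub>R d))"
        using smooth near' unfolding L0_L1_smooth_def K_def mult.commute[of L1] by blast
      then show "norm (gradient f (z + t *\<^sub>R d) - gradient f z) \<le> K * norm (z - (z + t *\<^sub>R d))"
        by (simp add: norm_minus_commute)
    qed simp
    also have "\<dots> = t * (K * (norm d)\<^sup>2)"
      using t by (simp add: power2_eq_square)
    finally show "\<exists>y. (h has_real_derivative y) (at t) \<and> y \<le> 0"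
      using deriv by (intro exI conjI) auto
  qed simp
  then show ?thesis by (simp add: h_def K_def)
qed

text \<open>A step of length \<open>r\<close> against the gradient cannot lead below the infimum.
  The condition on \<open>r * L1\<close> keeps the step within the smoothness radius and lets half
  of the linear decrease \<open>r * a\<close> absorb the part of the curvature that grows with
  \<open>a\<close>. This makes gradients integrable wherever \<open>f\<close> is.\<close>

lemma norm_gradient_le:
  fixes f :: "'a::euclidean_space \<Rightarrow> real"
  assumes smooth: "L0_L1_smooth L0 L1 f" and bdd: "bdd_below (range f)"
    and r: "0 < r" and rL1: "r * L1 \<le> 1"
  shows "norm (gradient f z) \<le> 2 * (f z - (INF z. f z)) / r + L0 * r"
proof (cases "gradient f z = 0")
  case True
  have "(INF z. f z) \<le> f z" using bdd by (rule cINF_lower) simp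
  then show ?thesis using True r smooth by (simp add: L0_L1_smooth_def)
next
  case False
  define a where "a = norm (gradient f z)"
  define d where "d = - (r / a) *\<^sub>R gradient f z"
  have a: "0 < a" using False by (simp add: a_def)
  have L: "0 \<le> L0" "0 \<le> L1" using smooth by (auto simp: L0_L1_smooth_def)
  have nd: "norm d = r" using a r by (simp add: d_def flip: a_def)
  have "(INF z. f z) \<le> f (z + d)" using bdd by (rule cINF_lower) simp
  also have "\<dots> \<le> f z + gradient f z \<bullet> d + (L0 + L1 * norm (gradient f z)) / 2 * (norm d)\<^sup>2"
  proof (rule L0_L1_smooth_upper_bound[OF smooth])
    show "L1 = 0 \<or> norm d \<le> 1 / L1"
      using rL1 L unfolding nd by (cases "L1 = 0") (auto simp: pos_le_divide_eq)
  qed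
  also have "\<dots> = f z - r * a + (L0 + L1 * a) / 2 * r\<^sup>2"
    unfolding nd using a by (simp add: d_def dot_square_norm power2_eq_square flip: a_def)
  also have "\<dots> \<le> f z - r * a / 2 + L0 / 2 * r\<^sup>2"
  proof -
    have "(r * L1) * (a * r) \<le> 1 * (a * r)" using rL1 a r by (intro mult_right_mono) auto
    then show ?thesis by (simp add: power2_eq_square algebra_simps)
  qed
  finally have "a * r \<le> 2 * (f z - (INF z. f z)) + L0 * r * r"
    by (simp add: power2_eq_square algebra_simps)
  then show ?thesis using r by (simp add: field_simps flip: a_def)
qed

section \<open>Averages over one sample at a fixed point\<close>

context clip_sgd
begin

text \<open>Unbiasedness exhibits the gradient as a parameter integral of the jointly measurable
  \<open>G\<close>.\<close>

lemma gradient_measurable [measurable]: "gradient f \<in> borel_measurable borel"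
proof -
  have "(\<lambda>z. \<integral>s. G s z \<partial>D) \<in> borel_measurable borel"
    using G_measurable by (rule sample.borel_measurable_lebesgue_integral)
  then show ?thesis by (simp add: G_unbiased)
qed

lemma G_measurable_section [measurable]: "(\<lambda>s. G s z) \<in> borel_measurable D"
  using measurable_compose[OF measurable_Pair1' G_measurable, of z] by simp

lemma integrable_inner_clip:
  assumes "0 < c"
  shows "integrable D (\<lambda>s. g \<bullet> clip c (G s z))"
proof (rule sample.integrable_const_bound[where B = "norm g * c"])
  show "AE s in D. norm (g \<bullet> clip c (G s z)) \<le> norm g * c"
  proof (rule AE_I2)
    fix s
    have "\<bar>g \<bullet> clip c (G s z)\<bar> \<le> norm g * norm (clip c (G s z))"
      by (rule Cauchy_Schwarz_ineq2)
    also have "\<dots> \<le> norm g * c"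
      using assms by (intro mult_left_mono) (auto simp: norm_clip)
    finally show "norm (g \<bullet> clip c (G s z)) \<le> norm g * c" by simp
  qed
qed measurable

lemma integrable_norm_clip_power2:
  assumes "0 < c"
  shows "integrable D (\<lambda>s. (norm (clip c (G s z)))\<^sup>2)"
  using assms
  by (intro sample.integrable_const_bound[where B = "c\<^sup>2"]) (auto simp: norm_clip intro!: power_mono)

lemma expectation_inner_noise: "(\<integral>s. g \<bullet> (G s z - gradient f z) \<partial>D) = 0"
  by (simp add: G_integrable G_unbiased sample.prob_space inner_diff_right)

text \<open>The common route from pointwise bounds to expectations: the term with \<open>q\<close>
  averages to zero, and the squared noise to at most \<open>\<sigma>\<^sup>2\<close>.\<close>

lemma expectation_inner_clip_ge:
  assumes c: "0 < c" and r: "0 \<le> r"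
    and bound: "\<And>s. p + q * (gradient f z \<bullet> (G s z - gradient f z))
      - r * (norm (G s z - gradient f z))\<^sup>2 \<le> gradient f z \<bullet> clip c (G s z)"
  shows "p - r * \<sigma>\<^sup>2 \<le> (\<integral>s. gradient f z \<bullet> clip c (G s z) \<partial>D)"
proof -
  have int: "integrable D (\<lambda>s. gradient f z \<bullet> (G s z - gradient f z))"
    using G_integrable by (intro integrable_inner_right) simp
  have "p - r * \<sigma>\<^sup>2 \<le> p - r * (\<integral>s. (norm (G s z - gradient f z))\<^sup>2 \<partial>D)"
    using mult_left_mono[OF G_variance r] by simp
  also have "\<dots> = (\<integral>s. p + q * (gradient f z \<bullet> (G s z - gradient f z))
      - r * (norm (G s z - gradient f z))\<^sup>2 \<partial>D)"
    using int G_square_integrable[of z]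
    by (simp add: expectation_inner_noise sample.prob_space)
  also have "\<dots> \<le> (\<integral>s. gradient f z \<bullet> clip c (G s z) \<partial>D)"
    using bound int G_square_integrable[of z] integrable_inner_clip[OF c]
    by (intro integral_mono) auto
  finally show ?thesis .
qed

text \<open>Each regime of \<open>bias_term\<close> has its own pointwise bound. In the two regimes
  of small \<open>\<sigma>\<close>, a large gradient dominates the noise and incurs no bias at all,
  so only small gradients determine the error there.\<close>

lemma expectation_inner_clip_ge_half:
  assumes c: "0 < c" and \<sigma>: "0 \<le> \<sigma>"
  shows "norm (gradient f z) * min (norm (gradient f z)) c / 2 - bias_term c \<sigma> / 2
    \<le> (\<integral>s. gradient f z \<bullet> clip c (G s z) \<partial>D)" (is "?\<phi> / 2 - _ \<le> ?E")
proof -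
  define g where "g = gradient f z"
  define a where "a = norm g"
  have a0: "0 \<le> a" by (simp add: a_def)
  have E: "p - r * \<sigma>\<^sup>2 \<le> ?E"
    if "0 \<le> r" "\<And>s. p + q * (g \<bullet> (G s z - g)) - r * (norm (G s z - g))\<^sup>2 \<le> g \<bullet> clip c (G s z)"
    for p q r
    using expectation_inner_clip_ge[OF c that(1)] that(2) unfolding g_def .
  \<comment> \<open>With \<open>\<sigma>\<close> at most \<open>m / 2\<close>, the variance costs
    \<open>a / m * \<sigma>\<^sup>2\<close>, at most a quarter of
    \<open>a * min a c\<close>.\<close>
  have large: "a * min a c / 2 \<le> ?E" if "0 < m" "2 * \<sigma> \<le> m" "m \<le> a" "m \<le> c" for m
  proof -
    have "3 / 4 * (a * min a c) - a / m * \<sigma>\<^sup>2 \<le> ?E"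
      using that a0 inner_clip_ge_three_quarters[OF c that(1), of g "G _ z"]
      by (intro E[of _ _ 0]) (auto simp: a_def algebra_simps)
    moreover have "(2 * \<sigma>)\<^sup>2 \<le> m\<^sup>2" using that \<sigma> by (intro power_mono) auto
    then have "\<sigma>\<^sup>2 / m \<le> m / 4" using that by (simp add: field_simps power2_eq_square)
    with that have "\<sigma>\<^sup>2 / m \<le> min a c / 4" by (simp add: min_def)
    from mult_left_mono[OF this a0] have "a / m * \<sigma>\<^sup>2 \<le> (a * min a c) / 4" by simp
    ultimately show ?thesis by linarith
  qed
  have W: "0 \<le> bias_term c \<sigma>" using bias_term_nonneg[OF c \<sigma>] .
  consider "\<sigma> \<le> c / 4" "a \<le> c / 2" | "\<sigma> \<le> c / 4" "c / 2 < a"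
    | "c / 4 < \<sigma>" "\<sigma> \<le> c / 2" "a \<le> c" | "c / 4 < \<sigma>" "\<sigma> \<le> c / 2" "c < a"
    | "c / 2 < \<sigma>" "\<sigma> \<le> 3 * c" | "3 * c < \<sigma>" by linarith
  then have "a * min a c / 2 - bias_term c \<sigma> / 2 \<le> ?E"
  proof cases
    case 1
    define b where "b = \<sigma>\<^sup>2 / (2 * c)"
    have "a\<^sup>2 - a / (2 * c) * \<sigma>\<^sup>2 \<le> ?E"
      using 1 c a0 inner_clip_ge_unbiased[OF c, of g "G _ z"]
      by (intro E[of _ _ 1]) (auto simp: a_def)
    moreover have "a / (2 * c) * \<sigma>\<^sup>2 = a * b" by (simp add: b_def)
    moreover have "bias_term c \<sigma> = b\<^sup>2"
      using 1 by (simp add: bias_term_def b_def power_divide power_mult_distrib flip: power_mult)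
    moreover have "0 \<le> (a - b)\<^sup>2" by simp
    moreover have "min a c = a" using 1 c by simp
    ultimately show ?thesis by (simp add: power2_eq_square algebra_simps)
  next
    case 2
    with c W large[of "c / 2"] show ?thesis by simp
  next
    case 3
    have "a\<^sup>2 / 2 - 1 / 2 * \<sigma>\<^sup>2 \<le> ?E"
    proof (rule E[of _ _ 0])
      fix s
      have "0 \<le> (a - norm (G s z - g))\<^sup>2" by simp
      then show "a\<^sup>2 / 2 + 0 * (g \<bullet> (G s z - g)) - 1 / 2 * (norm (G s z - g))\<^sup>2 \<le> g \<bullet> clip c (G s z)"
        using inner_clip_ge_minus_dist[OF c, of g "G s z"] 3
        by (simp add: a_def power2_eq_square algebra_simps)
    qed simp
    then show ?thesis using 3 by (simp add: bias_term_def power2_eq_square)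
  next
    case 4
    with c W large[of c] show ?thesis by simp
  next
    case 5
    have "a * min a c / 2 - 1 * \<sigma>\<^sup>2 \<le> ?E"
      using inner_clip_ge_quadratic[OF c, of g "G _ z"] by (intro E[of _ _ 0]) (auto simp: a_def)
    then show ?thesis using 5 c by (simp add: bias_term_def)
  next
    case 6
    have \<sigma>0: "0 < \<sigma>" using 6 c by linarith
    \<comment> \<open>Young's inequality with weight \<open>\<sigma>\<close> replaces the noise norm
      by its square. The constant part and the variance part then cost the same, together
      \<open>3 * c * \<sigma>\<close>.\<close>
    have "(a * min a c / 2 - 3 / 2 * c * \<sigma>) - 3 / 2 * c / \<sigma> * \<sigma>\<^sup>2 \<le> ?E"
    proof (rule E[of _ _ 0])
      show "0 \<le> 3 / 2 * c / \<sigma>" using c \<sigma>0 by simp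
      fix s
      have "0 \<le> (\<sigma> - norm (G s z - g))\<^sup>2" by simp
      then have "2 * norm (G s z - g) \<le> \<sigma> + (norm (G s z - g))\<^sup>2 / \<sigma>"
        using \<sigma>0 by (simp add: power2_eq_square field_simps)
      from mult_left_mono[OF this, of "3 / 2 * c"] c
      have "3 * c * norm (G s z - g) \<le> 3 / 2 * c * \<sigma> + 3 / 2 * c / \<sigma> * (norm (G s z - g))\<^sup>2"
        by (simp add: algebra_simps)
      then show "a * min a c / 2 - 3 / 2 * c * \<sigma> + 0 * (g \<bullet> (G s z - g))
          - 3 / 2 * c / \<sigma> * (norm (G s z - g))\<^sup>2 \<le> g \<bullet> clip c (G s z)"
        using inner_clip_ge_linear[OF c, of g "G s z"] by (simp add: a_def)
    qed
    moreover have "3 / 2 * c / \<sigma> * \<sigma>\<^sup>2 = 3 / 2 * c * \<sigma>"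
      using \<sigma>0 by (simp add: power2_eq_square)
    moreover have "bias_term c \<sigma> = 6 * c * \<sigma>" using 6 c by (simp add: bias_term_def)
    ultimately show ?thesis by linarith
  qed
  then show ?thesis by (simp add: a_def g_def)
qed

text \<open>One bound is the clipping radius; the other drops the clipping and decomposes the second
  moment into squared mean and variance.\<close>

lemma expectation_norm_clip_power2_le:
  assumes c: "0 < c"
  shows "(\<integral>s. (norm (clip c (G s z)))\<^sup>2 \<partial>D) \<le> min (c\<^sup>2) ((norm (gradient f z))\<^sup>2 + \<sigma>\<^sup>2)"
proof -
  define g where "g = gradient f z"
  have int: "integrable D (\<lambda>s. g \<bullet> (G s z - g))"
    using G_integrable by (intro integrable_inner_right) simp
  have sq: "integrable D (\<lambda>s. (norm (G s z - g))\<^sup>2)"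
    using G_square_integrable[of z] by (simp add: g_def)
  have "(norm (clip c (G s z)))\<^sup>2 \<le> (norm g)\<^sup>2 + 2 * (g \<bullet> (G s z - g)) + (norm (G s z - g))\<^sup>2" for s
  proof -
    have "(norm (clip c (G s z)))\<^sup>2 \<le> (norm (G s z))\<^sup>2"
      using c by (intro power_mono) (auto simp: norm_clip)
    also have "\<dots> = (norm g)\<^sup>2 + 2 * (g \<bullet> (G s z - g)) + (norm (G s z - g))\<^sup>2"
      by (simp add: power2_norm_eq_inner inner_diff_left inner_diff_right inner_commute)
    finally show ?thesis .
  qed
  then have "(\<integral>s. (norm (clip c (G s z)))\<^sup>2 \<partial>D)
      \<le> (\<integral>s. (norm g)\<^sup>2 + 2 * (g \<bullet> (G s z - g)) + (norm (G s z - g))\<^sup>2 \<partial>D)"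
    using int sq integrable_norm_clip_power2[OF c] by (intro integral_mono) auto
  also have "\<dots> = (norm g)\<^sup>2 + (\<integral>s. (norm (G s z - g))\<^sup>2 \<partial>D)"
    using int sq expectation_inner_noise[of g z] by (simp add: sample.prob_space g_def)
  also have "\<dots> \<le> (norm g)\<^sup>2 + \<sigma>\<^sup>2"
    using G_variance[of z] by (simp add: g_def)
  finally have 1: "(\<integral>s. (norm (clip c (G s z)))\<^sup>2 \<partial>D) \<le> (norm (gradient f z))\<^sup>2 + \<sigma>\<^sup>2"
    by (simp add: g_def)
  have "(\<integral>s. (norm (clip c (G s z)))\<^sup>2 \<partial>D) \<le> (\<integral>s. c\<^sup>2 \<partial>D)"
    using c integrable_norm_clip_power2[OF c] by (intro integral_mono) (auto simp: norm_clip)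
  with 1 show ?thesis by (simp add: sample.prob_space)
qed

text \<open>For \<open>a\<close> at most \<open>c\<close> the curvature is at most
  \<open>L0 + c * L1\<close>, and the two moment bounds combine. For larger \<open>a\<close> the
  second moment is capped at \<open>c\<^sup>2\<close>, so the left side grows only linearly in
  \<open>a\<close>, as does \<open>a * c\<close>.\<close>

lemma expectation_curvature_le:
  assumes c: "0 < c" and L0: "0 \<le> L0" and L1: "0 \<le> L1"
  shows "(L0 + L1 * norm (gradient f z)) * (\<integral>s. (norm (clip c (G s z)))\<^sup>2 \<partial>D)
    \<le> (L0 + c * L1) * (norm (gradient f z) * min (norm (gradient f z)) c + min (\<sigma>\<^sup>2) (c\<^sup>2))"
proof -
  define a where "a = norm (gradient f z)"
  define E where "E = (\<integral>s. (norm (clip c (G s z)))\<^sup>2 \<partial>D)"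
  have a: "0 \<le> a" by (simp add: a_def)
  have E: "0 \<le> E" "E \<le> c\<^sup>2" "E \<le> a\<^sup>2 + \<sigma>\<^sup>2"
    using expectation_norm_clip_power2_le[OF c, of z] by (auto simp: E_def a_def)
  have "(L0 + L1 * a) * E \<le> (L0 + c * L1) * (a * min a c + min (\<sigma>\<^sup>2) (c\<^sup>2))"
  proof (cases "a \<le> c")
    case True
    have "L1 * a \<le> c * L1" using True L1 by (simp add: mult.commute mult_left_mono)
    moreover have "E \<le> a * min a c + min (\<sigma>\<^sup>2) (c\<^sup>2)"
      using E True a by (auto simp: min_def power2_eq_square intro: add_increasing)
    ultimately show ?thesis
      using L0 L1 E c by (intro mult_mono) auto
  next
    case False
    have "(L0 + L1 * a) * E \<le> (L0 + L1 * a) * c\<^sup>2"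
      using E L0 L1 a by (intro mult_left_mono) auto
    also have "\<dots> \<le> (L0 + c * L1) * (a * c)"
      using False L0 c mult_left_mono[of c a "L0 * c"] by (simp add: power2_eq_square algebra_simps)
    also have "\<dots> \<le> (L0 + c * L1) * (a * min a c + min (\<sigma>\<^sup>2) (c\<^sup>2))"
      using False L0 L1 c by (intro mult_left_mono) auto
    finally show ?thesis .
  qed
  then show ?thesis by (simp add: a_def E_def)
qed

section \<open>Independence of the current iterate and the fresh sample\<close>

definition past :: "nat \<Rightarrow> 'w measure"
  where "past t = vimage_algebra (space M) (\<lambda>\<omega>. (x 0 \<omega>, \<lambda>i\<in>{..<t}. \<xi> i \<omega>))
    (borel \<Otimes>\<^sub>M Pi\<^sub>M {..<t} (\<lambda>_. D))"

lemma past_generator_space: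
  "(\<lambda>\<omega>. (x 0 \<omega>, \<lambda>i\<in>{..<t}. \<xi> i \<omega>)) \<in> space M \<rightarrow> space (borel \<Otimes>\<^sub>M Pi\<^sub>M {..<t} (\<lambda>_. D))"
  using measurable_space[OF \<xi>_measurable] by (auto simp: space_pair_measure space_PiM PiE_iff)

lemma past_generator_measurable:
  "(\<lambda>\<omega>. (x 0 \<omega>, \<lambda>i\<in>{..<t}. \<xi> i \<omega>)) \<in> past t \<rightarrow>\<^sub>M borel \<Otimes>\<^sub>M Pi\<^sub>M {..<t} (\<lambda>_. D)"
  unfolding past_def by (rule measurable_vimage_algebra1[OF past_generator_space])

lemma x0_past: "x 0 \<in> borel_measurable (past t)"
  using measurable_compose[OF past_generator_measurable measurable_fst] by simp

lemma \<xi>_past: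
  assumes "i < t"
  shows "\<xi> i \<in> measurable (past t) D"
proof -
  have "(\<lambda>y. y i) \<in> measurable (Pi\<^sub>M {..<t} (\<lambda>_. D)) D"
    using assms by (intro measurable_component_singleton) auto
  from measurable_compose[OF measurable_compose[OF past_generator_measurable measurable_snd] this]
  show ?thesis using assms by simp
qed

lemma space_past [simp]: "space (past t) = space M"
  by (simp add: past_def)

text \<open>Stated for all \<open>u\<close> up to \<open>t\<close> so that the induction runs inside
  one sigma-algebra and never has to compare the pasts of different steps.\<close>

lemma x_past_aux: "u \<le> t \<Longrightarrow> x u \<in> borel_measurable (past t)"
proof (induction u)
  case (Suc u)
  then have x: "x u \<in> borel_measurable (past t)" and \<xi>: "\<xi> u \<in> measurable (past t) D"
    using \<xi>_past[of u t] by auto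
  have "(\<lambda>\<omega>. G (\<xi> u \<omega>) (x u \<omega>)) \<in> borel_measurable (past t)"
    using measurable_compose[OF measurable_Pair[OF x \<xi>] G_measurable] by simp
  then have "(\<lambda>\<omega>. x u \<omega> - \<eta> *\<^sub>R clip c (G (\<xi> u \<omega>) (x u \<omega>))) \<in> borel_measurable (past t)"
    using x by measurable
  then show ?case
    by (subst measurable_cong[OF x_step]) auto
qed (rule x0_past)

lemma x_past: "x t \<in> borel_measurable (past t)"
  by (rule x_past_aux) simp

lemma x_measurable [measurable]: "x t \<in> borel_measurable M"
proof -
  have "(\<lambda>\<omega>. (x 0 \<omega>, \<lambda>i\<in>{..<t}. \<xi> i \<omega>)) \<in> measurable M (borel \<Otimes>\<^sub>M Pi\<^sub>M {..<t} (\<lambda>_. D))"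
    using x0_measurable \<xi>_measurable by (intro measurable_Pair measurable_restrict) auto
  then have "sets (past t) \<subseteq> sets M"
    unfolding past_def by (rule sets_image_in_sets[rotated]) simp_all
  then have "subalgebra M (past t)" by (simp add: subalgebra_def)
  then show ?thesis using x_past by (rule measurable_from_subalg)
qed

declare \<xi>_measurable [measurable]

text \<open>Preimages under \<open>x t\<close> lie in \<open>past t\<close>, so
  \<open>\<xi>_fresh\<close> makes both measures agree on rectangles, which determine the product.
  This is independence in the form that Fubini's theorem uses.\<close>

lemma distr_iterate_sample:
  "distr M (borel \<Otimes>\<^sub>M D) (\<lambda>\<omega>. (x t \<omega>, \<xi> t \<omega>)) = distr M borel (x t) \<Otimes>\<^sub>M D"
proof -
  interpret X: prob_space "distr M borel (x t)" by (rule prob_space_distr) simp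
  interpret XD: pair_prob_space "distr M borel (x t)" D ..
  show ?thesis
  proof (rule pair_measure_eqI[symmetric])
    show "sigma_finite_measure (distr M borel (x t))" by unfold_locales
    show "sigma_finite_measure D" by unfold_locales
    show "sets (distr M borel (x t) \<Otimes>\<^sub>M D) = sets (distr M (borel \<Otimes>\<^sub>M D) (\<lambda>\<omega>. (x t \<omega>, \<xi> t \<omega>)))"
      by (simp cong: sets_pair_measure_cong)
    fix A B assume "A \<in> sets (distr M borel (x t))" "B \<in> sets D"
    then have A [measurable]: "A \<in> sets borel" and B [measurable]: "B \<in> sets D" by auto
    define A' where "A' = x t -` A \<inter> space M"
    define B' where "B' = \<xi> t -` B \<inter> space M"
    have "A' \<in> sets (past t)"
      using measurable_sets[OF x_past A] by (simp add: A'_def)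
    moreover have "B' \<in> sets (vimage_algebra (space M) (\<xi> t) D)"
      using B by (auto simp: B'_def intro: in_vimage_algebra)
    ultimately have ind: "prob (A' \<inter> B') = prob A' * prob B'"
      using indep_setD[OF \<xi>_fresh[of t]] by (simp add: past_def)
    have "emeasure D B = emeasure (distr M D (\<xi> t)) B" by (simp add: \<xi>_distr)
    also have "\<dots> = prob B'"
      by (simp add: emeasure_distr B'_def emeasure_eq_measure)
    finally have "emeasure (distr M borel (x t)) A * emeasure D B = ennreal (prob A') * ennreal (prob B')"
      by (simp add: emeasure_distr A'_def emeasure_eq_measure)
    also have "\<dots> = emeasure M (A' \<inter> B')"
      by (simp add: ind emeasure_eq_measure ennreal_mult)
    also have "A' \<inter> B' = (\<lambda>\<omega>. (x t \<omega>, \<xi> t \<omega>)) -` (A \<times> B) \<inter> space M"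
      by (auto simp: A'_def B'_def)
    also have "emeasure M \<dots> = emeasure (distr M (borel \<Otimes>\<^sub>M D) (\<lambda>\<omega>. (x t \<omega>, \<xi> t \<omega>))) (A \<times> B)"
      by (subst emeasure_distr) auto
    finally show "emeasure (distr M borel (x t)) A * emeasure D B
        = emeasure (distr M (borel \<Otimes>\<^sub>M D) (\<lambda>\<omega>. (x t \<omega>, \<xi> t \<omega>))) (A \<times> B)" .
  qed
qed

text \<open>Fubini for the joint law. It plays the part of conditioning on the past: the inner
  integral averages over the sample with the iterate frozen.\<close>

lemma expectation_iterate_sample:
  fixes H :: "'a \<times> 's \<Rightarrow> real"
  assumes H [measurable]: "H \<in> borel_measurable (borel \<Otimes>\<^sub>M D)"
    and int: "integrable M (\<lambda>\<omega>. H (x t \<omega>, \<xi> t \<omega>))"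
  shows "integrable M (\<lambda>\<omega>. \<integral>s. H (x t \<omega>, s) \<partial>D)"
    and "(\<integral>\<omega>. H (x t \<omega>, \<xi> t \<omega>) \<partial>M) = (\<integral>\<omega>. (\<integral>s. H (x t \<omega>, s) \<partial>D) \<partial>M)"
proof -
  interpret X: prob_space "distr M borel (x t)" by (rule prob_space_distr) simp
  interpret XD: pair_prob_space "distr M borel (x t)" D ..
  have "integrable (distr M (borel \<Otimes>\<^sub>M D) (\<lambda>\<omega>. (x t \<omega>, \<xi> t \<omega>))) H"
    using int by (subst integrable_distr_eq) auto
  then have int': "integrable (distr M borel (x t) \<Otimes>\<^sub>M D) H"
    by (simp add: distr_iterate_sample)
  have meas: "(\<lambda>z. \<integral>s. H (z, s) \<partial>D) \<in> borel_measurable borel"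
    by (rule sample.borel_measurable_lebesgue_integral) simp
  have "integrable (distr M borel (x t)) (\<lambda>z. \<integral>s. H (z, s) \<partial>D)"
    using int' by (rule XD.integrable_fst')
  then show "integrable M (\<lambda>\<omega>. \<integral>s. H (x t \<omega>, s) \<partial>D)"
    using meas by (subst (asm) integrable_distr_eq) auto
  have "(\<integral>\<omega>. H (x t \<omega>, \<xi> t \<omega>) \<partial>M) = (\<integral>p. H p \<partial>distr M (borel \<Otimes>\<^sub>M D) (\<lambda>\<omega>. (x t \<omega>, \<xi> t \<omega>)))"
    by (subst integral_distr) auto
  also have "\<dots> = (\<integral>z. (\<integral>s. H (z, s) \<partial>D) \<partial>distr M borel (x t))"
    unfolding distr_iterate_sample by (rule XD.integral_fst'[OF int', symmetric])
  also have "\<dots> = (\<integral>\<omega>. (\<integral>s. H (x t \<omega>, s) \<partial>D) \<partial>M)"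
    using meas by (subst integral_distr) auto
  finally show "(\<integral>\<omega>. H (x t \<omega>, \<xi> t \<omega>) \<partial>M) = (\<integral>\<omega>. (\<integral>s. H (x t \<omega>, s) \<partial>D) \<partial>M)" .
qed

end

section \<open>One-step increments and integrability along the iterates\<close>

locale smooth_clip_sgd = clip_sgd M D f G c \<eta> \<sigma> \<xi> x
  for M :: "'w measure" and D :: "'s measure" and f :: "'a::euclidean_space \<Rightarrow> real"
    and G c \<eta> \<sigma> \<xi> x +
  fixes L0 L1 :: real
  assumes smooth: "L0_L1_smooth L0 L1 f"
    and bounded_below: "bdd_below (range f)"
    and c_pos: "0 < c" and \<eta>_pos: "0 < \<eta>" and \<sigma>_nonneg: "0 \<le> \<sigma>"
    and stepsize: "\<eta> * (L0 + c * L1) < 1"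
begin

lemma L_nonneg: "0 \<le> L0" "0 \<le> L1"
  using smooth by (auto simp: L0_L1_smooth_def)

lemma step_within_radius: "\<eta> * c * L1 \<le> 1"
proof -
  have "0 \<le> \<eta> * L0" using \<eta>_pos L_nonneg by simp
  then show ?thesis using stepsize by (simp add: algebra_simps)
qed

lemma f_measurable [measurable]: "f \<in> borel_measurable borel"
proof (rule borel_measurable_continuous_onI)
  show "continuous_on UNIV f"
    using smooth by (auto simp: L0_L1_smooth_def continuous_on_eq_continuous_at
        intro: differentiable_imp_continuous_within)
qed

lemma INF_le: "(INF z. f z) \<le> f z"
  using bounded_below by (rule cINF_lower) simp

text \<open>The upper bound on the change of \<open>f\<close> in one step. It takes a pair so as to
  fit the function \<open>H\<close> of \<open>expectation_iterate_sample\<close>.\<close>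

definition increment :: "'a \<times> 's \<Rightarrow> real"
  where "increment p = \<eta>\<^sup>2 / 2 * ((L0 + L1 * norm (gradient f (fst p))) * (norm (clip c (G (snd p) (fst p))))\<^sup>2)
    - \<eta> * (gradient f (fst p) \<bullet> clip c (G (snd p) (fst p)))"

lemma f_step_le: "f (z - \<eta> *\<^sub>R clip c (G s z)) \<le> f z + increment (z, s)"
proof -
  have "norm (- \<eta> *\<^sub>R clip c (G s z)) \<le> \<eta> * c"
    using \<eta>_pos c_pos by (simp add: norm_clip)
  moreover have "L1 = 0 \<or> \<eta> * c \<le> 1 / L1"
    using step_within_radius L_nonneg by (cases "L1 = 0") (auto simp: pos_le_divide_eq)
  ultimately have "L1 = 0 \<or> norm (- \<eta> *\<^sub>R clip c (G s z)) \<le> 1 / L1" by linarith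
  from L0_L1_smooth_upper_bound[OF smooth this, of z] show ?thesis
    by (simp add: increment_def power_mult_distrib algebra_simps add_divide_distrib)
qed

text \<open>The bound is free of the sample and affine in the gradient norm, so the increment
  inherits integrability from the gradient.\<close>

lemma abs_increment_le:
  "\<bar>increment (z, s)\<bar> \<le> \<eta>\<^sup>2 / 2 * ((L0 + L1 * norm (gradient f z)) * c\<^sup>2) + \<eta> * (norm (gradient f z) * c)"
proof -
  let ?v = "clip c (G s z)"
  have v: "norm ?v \<le> c" using c_pos by (simp add: norm_clip)
  have "\<bar>gradient f z \<bullet> ?v\<bar> \<le> norm (gradient f z) * norm ?v"
    by (rule Cauchy_Schwarz_ineq2)
  also have "\<dots> \<le> norm (gradient f z) * c" using v by (intro mult_left_mono) auto
  finally have "\<eta> * \<bar>gradient f z \<bullet> ?v\<bar> \<le> \<eta> * (norm (gradient f z) * c)"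
    using \<eta>_pos by (intro mult_left_mono) auto
  moreover have "\<eta>\<^sup>2 / 2 * ((L0 + L1 * norm (gradient f z)) * (norm ?v)\<^sup>2)
      \<le> \<eta>\<^sup>2 / 2 * ((L0 + L1 * norm (gradient f z)) * c\<^sup>2)"
    using v L_nonneg by (intro mult_left_mono power_mono) auto
  moreover have "\<bar>increment (z, s)\<bar>
      \<le> \<eta>\<^sup>2 / 2 * ((L0 + L1 * norm (gradient f z)) * (norm ?v)\<^sup>2) + \<eta> * \<bar>gradient f z \<bullet> ?v\<bar>"
    using abs_triangle_ineq4[of "\<eta>\<^sup>2 / 2 * ((L0 + L1 * norm (gradient f z)) * (norm ?v)\<^sup>2)"
        "\<eta> * (gradient f z \<bullet> ?v)"] L_nonneg \<eta>_pos
    by (simp add: increment_def abs_mult)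
  ultimately show ?thesis by linarith
qed

lemma increment_measurable [measurable]: "increment \<in> borel_measurable (borel \<Otimes>\<^sub>M D)"
proof -
  have [measurable]: "(\<lambda>p. G (snd p) (fst p)) \<in> borel_measurable (borel \<Otimes>\<^sub>M D)"
    using G_measurable by (simp add: case_prod_beta')
  show ?thesis unfolding increment_def[abs_def] by measurable
qed

text \<open>\<open>norm_gradient_le\<close> with radius \<open>\<eta> * c\<close> dominates the
  gradient by an affine function of \<open>f\<close>.\<close>

lemma integrable_gradient_if_integrable_f:
  assumes "integrable M (\<lambda>\<omega>. f (x t \<omega>))"
  shows "integrable M (\<lambda>\<omega>. norm (gradient f (x t \<omega>)))"
proof (rule Bochner_Integration.integrable_bound)
  show "integrable M (\<lambda>\<omega>. 2 * (f (x t \<omega>) - (INF z. f z)) / (\<eta> * c) + L0 * (\<eta> * c))"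
    using assms by simp
  show "AE \<omega> in M. norm (norm (gradient f (x t \<omega>)))
      \<le> norm (2 * (f (x t \<omega>) - (INF z. f z)) / (\<eta> * c) + L0 * (\<eta> * c))"
  proof (rule AE_I2)
    fix \<omega>
    have "norm (gradient f (x t \<omega>)) \<le> 2 * (f (x t \<omega>) - (INF z. f z)) / (\<eta> * c) + L0 * (\<eta> * c)"
      using c_pos \<eta>_pos by (intro norm_gradient_le[OF smooth bounded_below _ step_within_radius]) simp
    then show "norm (norm (gradient f (x t \<omega>)))
        \<le> norm (2 * (f (x t \<omega>) - (INF z. f z)) / (\<eta> * c) + L0 * (\<eta> * c))"
      by simp
  qed
qed measurable

lemma integrable_increment_if_integrable_f:
  assumes "integrable M (\<lambda>\<omega>. f (x t \<omega>))"
  shows "integrable M (\<lambda>\<omega>. increment (x t \<omega>, \<xi> t \<omega>))"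
proof (rule Bochner_Integration.integrable_bound)
  show "integrable M (\<lambda>\<omega>. \<eta>\<^sup>2 / 2 * ((L0 + L1 * norm (gradient f (x t \<omega>))) * c\<^sup>2)
      + \<eta> * (norm (gradient f (x t \<omega>)) * c))"
    using integrable_gradient_if_integrable_f[OF assms] by simp
  show "AE \<omega> in M. norm (increment (x t \<omega>, \<xi> t \<omega>))
      \<le> norm (\<eta>\<^sup>2 / 2 * ((L0 + L1 * norm (gradient f (x t \<omega>))) * c\<^sup>2)
        + \<eta> * (norm (gradient f (x t \<omega>)) * c))"
  proof (rule AE_I2)
    fix \<omega>
    show "norm (increment (x t \<omega>, \<xi> t \<omega>))
      \<le> norm (\<eta>\<^sup>2 / 2 * ((L0 + L1 * norm (gradient f (x t \<omega>))) * c\<^sup>2)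
        + \<eta> * (norm (gradient f (x t \<omega>)) * c))"
      unfolding real_norm_def by (rule order_trans[OF abs_increment_le abs_ge_self])
  qed
qed measurable

text \<open>The next value of \<open>f\<close> lies between the infimum and the current value plus
  the increment, so integrability passes from step to step.\<close>

lemma integrable_f_iterate: "integrable M (\<lambda>\<omega>. f (x t \<omega>))"
proof (induction t)
  case 0
  show ?case by (rule x0_integrable)
next
  case (Suc t)
  show ?case
  proof (rule Bochner_Integration.integrable_bound)
    show "integrable M (\<lambda>\<omega>. \<bar>INF z. f z\<bar> + \<bar>f (x t \<omega>)\<bar> + \<bar>increment (x t \<omega>, \<xi> t \<omega>)\<bar>)"
      using Suc integrable_increment_if_integrable_f[OF Suc] by simp
    show "AE \<omega> in M. norm (f (x (Suc t) \<omega>))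
        \<le> norm (\<bar>INF z. f z\<bar> + \<bar>f (x t \<omega>)\<bar> + \<bar>increment (x t \<omega>, \<xi> t \<omega>)\<bar>)"
    proof (rule AE_I2)
      fix \<omega> assume "\<omega> \<in> space M"
      then have "f (x (Suc t) \<omega>) \<le> f (x t \<omega>) + increment (x t \<omega>, \<xi> t \<omega>)"
        by (simp add: x_step f_step_le)
      with INF_le[of "x (Suc t) \<omega>"] show "norm (f (x (Suc t) \<omega>))
        \<le> norm (\<bar>INF z. f z\<bar> + \<bar>f (x t \<omega>)\<bar> + \<bar>increment (x t \<omega>, \<xi> t \<omega>)\<bar>)"
        unfolding real_norm_def by linarith
    qed
  qed measurable
qed

lemmas integrable_gradient = integrable_gradient_if_integrable_f[OF integrable_f_iterate]
lemmas integrable_increment = integrable_increment_if_integrable_f[OF integrable_f_iterate]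

section \<open>Expected descent, telescoping and the mean gradient norm\<close>

definition progress :: "'a \<Rightarrow> real"
  where "progress z = norm (gradient f z) * min (norm (gradient f z)) c"

text \<open>The error per step that does not fade as \<open>T\<close> grows, before multiplication
  by \<zeta>.\<close>

definition noise_floor :: real
  where "noise_floor = bias_term c \<sigma> + \<eta> * (L0 + c * L1) * min (\<sigma>\<^sup>2) (c\<^sup>2)"

lemma progress_measurable [measurable]: "progress \<in> borel_measurable borel"
  unfolding progress_def[abs_def] by measurable

lemma integrable_progress: "integrable M (\<lambda>\<omega>. progress (x t \<omega>))"
proof (rule Bochner_Integration.integrable_bound)
  show "integrable M (\<lambda>\<omega>. norm (gradient f (x t \<omega>)) * c)"
    using integrable_gradient by simp
  show "AE \<omega> in M. norm (progress (x t \<omega>)) \<le> norm (norm (gradient f (x t \<omega>)) * c)"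
    using c_pos by (intro AE_I2) (auto simp: progress_def abs_mult intro!: mult_left_mono)
qed measurable

text \<open>The half of \<open>progress\<close> kept by the bias estimate meets the factor 1/2 of
  the quadratic term, so both combine into the factor
  \<open>1 - \<eta> * (L0 + c * L1)\<close>.\<close>

lemma expectation_increment_le:
  "(\<integral>s. increment (z, s) \<partial>D) \<le> - (\<eta> / 2 * ((1 - \<eta> * (L0 + c * L1)) * progress z - noise_floor))"
proof -
  define I where "I = (\<integral>s. gradient f z \<bullet> clip c (G s z) \<partial>D)"
  define C where "C = (L0 + L1 * norm (gradient f z)) * (\<integral>s. (norm (clip c (G s z)))\<^sup>2 \<partial>D)"
  have "(\<integral>s. increment (z, s) \<partial>D) = \<eta>\<^sup>2 / 2 * C - \<eta> * I"
    using integrable_inner_clip[OF c_pos] integrable_norm_clip_power2[OF c_pos]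
    by (simp add: increment_def I_def C_def)
  moreover have "\<eta> * (progress z / 2 - bias_term c \<sigma> / 2) \<le> \<eta> * I"
    using expectation_inner_clip_ge_half[OF c_pos \<sigma>_nonneg, of z] \<eta>_pos
    by (intro mult_left_mono) (auto simp: progress_def I_def)
  moreover have "\<eta>\<^sup>2 / 2 * C \<le> \<eta>\<^sup>2 / 2 * ((L0 + c * L1) * (progress z + min (\<sigma>\<^sup>2) (c\<^sup>2)))"
    using expectation_curvature_le[OF c_pos L_nonneg, of z]
    by (intro mult_left_mono) (auto simp: progress_def C_def)
  ultimately have "(\<integral>s. increment (z, s) \<partial>D)
      \<le> \<eta>\<^sup>2 / 2 * ((L0 + c * L1) * (progress z + min (\<sigma>\<^sup>2) (c\<^sup>2))) - \<eta> * (progress z / 2 - bias_term c \<sigma> / 2)"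
    by linarith
  also have "\<dots> = - (\<eta> / 2 * ((1 - \<eta> * (L0 + c * L1)) * progress z - noise_floor))"
    by (simp add: noise_floor_def power2_eq_square algebra_simps)
  finally show ?thesis .
qed

lemma expected_descent:
  "(\<integral>\<omega>. f (x (Suc t) \<omega>) \<partial>M) \<le> (\<integral>\<omega>. f (x t \<omega>) \<partial>M)
    - \<eta> / 2 * ((1 - \<eta> * (L0 + c * L1)) * (\<integral>\<omega>. progress (x t \<omega>) \<partial>M) - noise_floor)"
proof -
  have "(\<integral>\<omega>. f (x (Suc t) \<omega>) \<partial>M) \<le> (\<integral>\<omega>. f (x t \<omega>) + increment (x t \<omega>, \<xi> t \<omega>) \<partial>M)"
    using integrable_f_iterate integrable_increment
    by (intro integral_mono) (auto simp: x_step f_step_le)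
  also have "\<dots> = (\<integral>\<omega>. f (x t \<omega>) \<partial>M) + (\<integral>\<omega>. (\<integral>s. increment (x t \<omega>, s) \<partial>D) \<partial>M)"
    using integrable_f_iterate integrable_increment
    by (simp add: expectation_iterate_sample(2)[OF increment_measurable integrable_increment])
  also have "(\<integral>\<omega>. (\<integral>s. increment (x t \<omega>, s) \<partial>D) \<partial>M)
      \<le> (\<integral>\<omega>. - (\<eta> / 2 * ((1 - \<eta> * (L0 + c * L1)) * progress (x t \<omega>) - noise_floor)) \<partial>M)"
    using integrable_progress expectation_increment_le
      expectation_iterate_sample(1)[OF increment_measurable integrable_increment]
    by (intro integral_mono) auto
  also have "\<dots> = - (\<eta> / 2 * ((1 - \<eta> * (L0 + c * L1)) * (\<integral>\<omega>. progress (x t \<omega>) \<partial>M) - noise_floor))"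
    using integrable_progress by (simp add: prob_space)
  finally show ?thesis by simp
qed

lemma INF_le_expectation: "(INF z. f z) \<le> (\<integral>\<omega>. f (x t \<omega>) \<partial>M)"
proof -
  have "(\<integral>\<omega>. (INF z. f z) \<partial>M) \<le> (\<integral>\<omega>. f (x t \<omega>) \<partial>M)"
    using integrable_f_iterate INF_le by (intro integral_mono) auto
  then show ?thesis by (simp add: prob_space)
qed

lemma sum_progress_le:
  "\<eta> / 2 * ((1 - \<eta> * (L0 + c * L1)) * (\<Sum>t<T. \<integral>\<omega>. progress (x t \<omega>) \<partial>M) - real T * noise_floor)
    \<le> (\<integral>\<omega>. f (x 0 \<omega>) \<partial>M) - (INF z. f z)"
proof -
  have "\<eta> / 2 * ((1 - \<eta> * (L0 + c * L1)) * (\<Sum>t<T. \<integral>\<omega>. progress (x t \<omega>) \<partial>M) - real T * noise_floor)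
      \<le> (\<integral>\<omega>. f (x 0 \<omega>) \<partial>M) - (\<integral>\<omega>. f (x T \<omega>) \<partial>M)"
  proof (induction T)
    case (Suc T)
    with expected_descent[of T] show ?case by (simp add: algebra_simps)
  qed simp
  with INF_le_expectation[of T] show ?thesis by linarith
qed

text \<open>Up to \<open>c\<close>, \<open>progress\<close> is the squared norm and the
  arithmetic-geometric mean inequality applies; beyond \<open>c\<close>, the first summand alone
  equals the norm. The bound is affine in \<open>progress\<close>, so it can be averaged before
  \<open>s\<close> is chosen.\<close>

lemma norm_gradient_le_progress:
  assumes "0 < s"
  shows "norm (gradient f z) \<le> progress z / c + (progress z / s + s) / 2"
proof (cases "norm (gradient f z) \<le> c")
  case True
  define a where "a = norm (gradient f z)"
  have "0 \<le> (a - s)\<^sup>2" by simp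
  then have "2 * a \<le> a * a / s + s"
    using assms by (simp add: power2_eq_square field_simps)
  moreover have "0 \<le> a * a / c" using c_pos by simp
  moreover have "progress z = a * a" using True by (simp add: progress_def a_def)
  ultimately have "a \<le> progress z / c + (progress z / s + s) / 2"
    by (intro add_increasing) auto
  then show ?thesis by (simp add: a_def)
next
  case False
  then show ?thesis using assms c_pos by (simp add: progress_def)
qed

lemma mean_gradient_le:
  assumes T: "T \<ge> 1" and R: "(\<Sum>t<T. \<integral>\<omega>. progress (x t \<omega>) \<partial>M) \<le> real T * R"
  shows "1 / real T * (\<Sum>t<T. \<integral>\<omega>. norm (gradient f (x t \<omega>)) \<partial>M) \<le> sqrt R + R / c"
proof -
  define A where "A = 1 / real T * (\<Sum>t<T. \<integral>\<omega>. norm (gradient f (x t \<omega>)) \<partial>M)"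
  have "0 \<le> (\<Sum>t<T. \<integral>\<omega>. progress (x t \<omega>) \<partial>M)"
    using c_pos by (intro sum_nonneg integral_nonneg_AE AE_I2) (simp add: progress_def)
  with R have "0 \<le> real T * R" by linarith
  then have R0: "0 \<le> R" using T by (simp add: zero_le_mult_iff)
  have bound: "A \<le> R / c + (R / s + s) / 2" if s: "0 < s" for s
  proof -
    have "(\<integral>\<omega>. norm (gradient f (x t \<omega>)) \<partial>M)
        \<le> (\<integral>\<omega>. (1 / c + 1 / (2 * s)) * progress (x t \<omega>) + s / 2 \<partial>M)" for t
      using integrable_gradient integrable_progress norm_gradient_le_progress[OF s]
      by (intro integral_mono) (auto simp: algebra_simps add_divide_distrib)
    then have "(\<Sum>t<T. \<integral>\<omega>. norm (gradient f (x t \<omega>)) \<partial>M)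
        \<le> (\<Sum>t<T. (1 / c + 1 / (2 * s)) * (\<integral>\<omega>. progress (x t \<omega>) \<partial>M) + s / 2)"
      using integrable_progress by (intro sum_mono) (simp add: prob_space)
    also have "\<dots> = (1 / c + 1 / (2 * s)) * (\<Sum>t<T. \<integral>\<omega>. progress (x t \<omega>) \<partial>M) + real T * (s / 2)"
      by (simp add: sum.distrib sum_distrib_left)
    also have "\<dots> \<le> (1 / c + 1 / (2 * s)) * (real T * R) + real T * (s / 2)"
      using R s c_pos by (intro add_right_mono mult_left_mono) auto
    also have "\<dots> = real T * (R / c + (R / s + s) / 2)"
      by (simp add: algebra_simps add_divide_distrib)
    finally show ?thesis
      using T by (simp add: A_def field_simps)
  qed
  have "A \<le> sqrt R + R / c"
  proof (cases "R = 0")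
    case True
    \<comment> \<open>The optimal weight \<open>sqrt R\<close> is zero here and thus inadmissible,
      so the weight tends to zero instead.\<close>
    have "A \<le> 0 + e" if "0 < e" for e
      using bound[OF that] True that by simp
    then show ?thesis using True field_le_epsilon[of A 0] by simp
  next
    case False
    with R0 have "R / sqrt R = sqrt R" "0 < sqrt R" by (auto simp: real_div_sqrt)
    with bound[of "sqrt R"] show ?thesis by simp
  qed
  then show ?thesis by (simp add: A_def)
qed

end

section \<open>Noise constants and conclusion\<close>

text \<open>Subadditivity of the square root separates bias from curvature noise, and
  \<open>\<zeta>\<close> at least 1 gives \<open>sqrt \<zeta> \<le> \<zeta>\<close>. Since
  \<open>m\<close> is at most both \<open>c * \<sigma>\<close> and \<open>\<sigma>\<^sup>2\<close>,
  the quotient \<open>m / c\<close> fits the third summand of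
  \<open>sqrt_bias_term_le\<close>.\<close>

lemma noise_bound:
  fixes c \<sigma> b \<zeta> :: real
  assumes c: "0 < c" and \<sigma>: "0 \<le> \<sigma>" and b: "0 \<le> b" "b \<le> 1" and \<zeta>: "1 \<le> \<zeta>"
  defines "N \<equiv> \<zeta> * (bias_term c \<sigma> + b * min (\<sigma>\<^sup>2) (c\<^sup>2))"
  shows "0 \<le> N" and "sqrt N + N / c \<le> 2 * \<zeta> * sqrt b * \<sigma> + 6 * \<zeta> * min (\<sigma>\<^sup>2 / c) (3 * \<sigma>)"
proof -
  define W where "W = bias_term c \<sigma>"
  define m where "m = min (\<sigma>\<^sup>2) (c\<^sup>2)"
  have W: "0 \<le> W" using bias_term_nonneg[OF c \<sigma>] by (simp add: W_def)
  have m: "0 \<le> m" "m \<le> \<sigma>\<^sup>2" by (simp_all add: m_def)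
  show "0 \<le> N" using W m b \<zeta> by (simp add: N_def flip: W_def m_def)
  have "m \<le> c * \<sigma>"
    using c \<sigma> mult_right_mono[of \<sigma> c \<sigma>] mult_left_mono[of c \<sigma> c]
    by (cases "\<sigma> \<le> c") (auto simp: m_def power2_eq_square min_le_iff_disj)
  with c m have mc: "m / c \<le> min \<sigma> (\<sigma>\<^sup>2 / c)"
    by (simp add: pos_divide_le_eq mult.commute divide_right_mono)
  have sqrt_\<zeta>: "sqrt \<zeta> \<le> \<zeta>"
    using \<zeta> by (intro real_le_lsqrt) (auto simp: power2_eq_square)
  have "sqrt (\<zeta> * W) \<le> \<zeta> * sqrt W"
    using sqrt_\<zeta> W by (simp add: real_sqrt_mult mult_right_mono)
  moreover have "sqrt (\<zeta> * b * m) \<le> \<zeta> * sqrt b * \<sigma>"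
  proof -
    have "sqrt m \<le> \<sigma>" using m \<sigma> by (intro real_le_lsqrt) auto
    then show ?thesis
      unfolding real_sqrt_mult using sqrt_\<zeta> b m \<zeta> by (intro mult_mono) auto
  qed
  moreover have "sqrt (\<zeta> * W + \<zeta> * b * m) \<le> sqrt (\<zeta> * W) + sqrt (\<zeta> * b * m)"
    using W m b \<zeta> by (intro sqrt_add_le_add_sqrt) auto
  moreover have "\<zeta> * b * m / c \<le> \<zeta> * min \<sigma> (\<sigma>\<^sup>2 / c)"
  proof -
    have "b * (m / c) \<le> 1 * (m / c)" using b m c by (intro mult_right_mono) auto
    with mc have "b * (m / c) \<le> min \<sigma> (\<sigma>\<^sup>2 / c)" by linarith
    from mult_left_mono[OF this, of \<zeta>] \<zeta> show ?thesis by simp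
  qed
  moreover have "\<zeta> * sqrt W + \<zeta> * W / c + \<zeta> * min \<sigma> (\<sigma>\<^sup>2 / c) \<le> 6 * \<zeta> * min (\<sigma>\<^sup>2 / c) (3 * \<sigma>)"
    using mult_left_mono[OF sqrt_bias_term_le[OF c \<sigma>], of \<zeta>] \<zeta>
    by (simp add: W_def distrib_left mult.assoc mult.left_commute[of \<zeta> 6])
  moreover have "\<zeta> * sqrt b * \<sigma> \<le> 2 * \<zeta> * sqrt b * \<sigma>" using \<zeta> b \<sigma> by simp
  moreover have "N = \<zeta> * W + \<zeta> * b * m" by (simp add: N_def W_def m_def distrib_left)
  ultimately show "sqrt N + N / c \<le> 2 * \<zeta> * sqrt b * \<sigma> + 6 * \<zeta> * min (\<sigma>\<^sup>2 / c) (3 * \<sigma>)"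
    by (simp only: add_divide_distrib)
qed

theorem theorem2:
  fixes f :: "real ^ 'd \<Rightarrow> real"
    and M :: "'w measure" and D :: "'s measure"
    and G :: "'s \<Rightarrow> real ^ 'd \<Rightarrow> real ^ 'd"
    and L0 L1 c \<eta> \<sigma> \<beta> \<Delta> \<zeta> :: real
    and \<xi> :: "nat \<Rightarrow> 'w \<Rightarrow> 's"
    and x :: "nat \<Rightarrow> 'w \<Rightarrow> real ^ 'd"
  assumes smooth: "L0_L1_smooth L0 L1 f"
    and bounded_below: "bdd_below (range f)"
    and c_pos: "0 < c" and \<eta>_pos: "0 < \<eta>" and \<sigma>_nonneg: "0 \<le> \<sigma>"
    and iterates: "clip_sgd M D f G c \<eta> \<sigma> \<xi> x"
    and \<beta>_eq: "\<beta> = L0 + c * L1"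
    and stepsize: "\<eta> * \<beta> < 1"
    and \<Delta>_eq: "\<Delta> = (\<integral>\<omega>. f (x 0 \<omega>) \<partial>M) - (INF z. f z)"
    and \<zeta>_eq: "\<zeta> = 1 / (1 - \<eta> * \<beta>)"
  shows "0 \<le> \<Delta> \<and>
    (\<forall>t. integrable M (\<lambda>\<omega>. norm (gradient f (x t \<omega>)))) \<and>
    (\<forall>T::nat. T \<ge> 1 \<longrightarrow>
      1 / real T * (\<Sum>t<T. \<integral>\<omega>. norm (gradient f (x t \<omega>)) \<partial>M)
        \<le> sqrt (2 * \<zeta> * \<Delta> / (\<eta> * real T)) + 2 * \<zeta> * \<Delta> / (\<eta> * real T * c)
          + 2 * \<zeta> * sqrt (\<eta> * \<beta>) * \<sigma> + 6 * \<zeta> * min (\<sigma>\<^sup>2 / c) (3 * \<sigma>))"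
proof (intro conjI allI impI)
  interpret clip_sgd M D f G c \<eta> \<sigma> \<xi> x by (rule iterates)
  interpret smooth_clip_sgd M D f G c \<eta> \<sigma> \<xi> x L0 L1
    using smooth bounded_below c_pos \<eta>_pos \<sigma>_nonneg stepsize unfolding \<beta>_eq by unfold_locales
  show \<Delta>: "0 \<le> \<Delta>"
    using INF_le_expectation[of 0] by (simp add: \<Delta>_eq)
  show "integrable M (\<lambda>\<omega>. norm (gradient f (x t \<omega>)))" for t
    by (rule integrable_gradient)
  fix T :: nat assume T: "T \<ge> 1"
  have b: "0 \<le> \<eta> * \<beta>" "\<eta> * \<beta> < 1" "\<eta> * \<beta> \<le> 1"
    using L_nonneg c_pos \<eta>_pos stepsize by (simp_all add: \<beta>_eq)
  then have \<zeta>: "1 \<le> \<zeta>" by (simp add: \<zeta>_eq)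
  \<comment> \<open>\<open>Q\<close> collects the initial gap and \<open>N\<close> the noise; their
    sum is the \<open>R\<close> of the overview.\<close>
  define Q where "Q = 2 * \<zeta> * \<Delta> / (\<eta> * real T)"
  define N where "N = \<zeta> * (bias_term c \<sigma> + \<eta> * \<beta> * min (\<sigma>\<^sup>2) (c\<^sup>2))"
  define S where "S = (\<Sum>t<T. \<integral>\<omega>. progress (x t \<omega>) \<partial>M)"
  have Q: "0 \<le> Q" using \<Delta> \<zeta> \<eta>_pos by (simp add: Q_def)
  have N: "N = \<zeta> * noise_floor" by (simp add: N_def noise_floor_def \<beta>_eq)
  have "\<eta> / 2 * ((1 - \<eta> * \<beta>) * S - real T * noise_floor) \<le> \<Delta>"
    using sum_progress_le[of T] by (simp add: S_def \<beta>_eq \<Delta>_eq)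
  \<comment> \<open>This factor normalises the coefficient of \<open>S\<close> to
    \<open>\<zeta> * (1 - \<eta> * \<beta>) = 1\<close>.\<close>
  then have "2 * \<zeta> / \<eta> * (\<eta> / 2 * ((1 - \<eta> * \<beta>) * S - real T * noise_floor)) \<le> 2 * \<zeta> / \<eta> * \<Delta>"
    using \<zeta> \<eta>_pos by (intro mult_left_mono) auto
  moreover have "2 * \<zeta> / \<eta> * (\<eta> / 2 * ((1 - \<eta> * \<beta>) * S - real T * noise_floor))
      = (\<zeta> * (1 - \<eta> * \<beta>)) * S - real T * N"
    using \<eta>_pos by (simp add: N right_diff_distrib)
  moreover have "\<zeta> * (1 - \<eta> * \<beta>) = 1" using b by (simp add: \<zeta>_eq)
  moreover have "2 * \<zeta> / \<eta> * \<Delta> = real T * Q" using T by (simp add: Q_def)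
  ultimately have "S \<le> real T * (Q + N)" by (simp add: distrib_left)
  then have "1 / real T * (\<Sum>t<T. \<integral>\<omega>. norm (gradient f (x t \<omega>)) \<partial>M) \<le> sqrt (Q + N) + (Q + N) / c"
    unfolding S_def by (rule mean_gradient_le[OF T])
  also have "\<dots> \<le> sqrt Q + Q / c + (sqrt N + N / c)"
    using sqrt_add_le_add_sqrt[OF Q noise_bound(1)[OF c_pos \<sigma>_nonneg b(1,3) \<zeta>]]
    by (simp add: N_def add_divide_distrib)
  also have "\<dots> \<le> sqrt Q + Q / c + (2 * \<zeta> * sqrt (\<eta> * \<beta>) * \<sigma> + 6 * \<zeta> * min (\<sigma>\<^sup>2 / c) (3 * \<sigma>))"
    using noise_bound(2)[OF c_pos \<sigma>_nonneg b(1,3) \<zeta>] unfolding N_def by simp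
  finally show "1 / real T * (\<Sum>t<T. \<integral>\<omega>. norm (gradient f (x t \<omega>)) \<partial>M)
        \<le> sqrt (2 * \<zeta> * \<Delta> / (\<eta> * real T)) + 2 * \<zeta> * \<Delta> / (\<eta> * real T * c)
          + 2 * \<zeta> * sqrt (\<eta> * \<beta>) * \<sigma> + 6 * \<zeta> * min (\<sigma>\<^sup>2 / c) (3 * \<sigma>)"
    by (simp add: Q_def)
qed

end
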